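(* For the extremist rules of orders $3$ and $4$, the density thresholds satisfy $\theta(3)=\theta(4)=0$.
   Context: Let $(\Omega,\pi)$ be an atomless probability space with separable $\sigma$-algebra. A kernel is a bounded symmetric measurable $W:\Omega^2\to\mathbb{R}$; $\mathcal{W}$ is the Banach space of kernels with $\|\cdot\|_\infty$; graphons are kernels with values in $[0,1]$; $\mathcal{W}_0$ is the set of graphons; $0$ denotes the constant-$0$ graphon; $\|W\|_1=\int|W|\,d\pi^2$; $d_\square(U,W)=\sup_{S,T\subseteq\Omega}|\int_{S\times T}(U-W)\,d\pi^2|$. For $k\in\mathbb{N}$, $\mathcal{H}_k$ is the set of graphs on $[k]$. A rule of order $k$ is a matrix $\mathcal{R}\in[0,1]^{\mathcal{H}_k\times\mathcal{H}_k}$ with row sums $1$. For a kernel $W$, $F\in\mathcal{H}_k$, distinct $a,b$, $x,y$: $t^{x,y}_{\mathrm{ind}}(F^{a,b},W)=\int\prod_{ij\in E(F)}W(x_i,x_j)\prod_{ij\notin E(F)}(1-W(x_i,x_j))\prod_{i\ne a,b}d\pi(x_i)$ with $x_a=x,x_b=y$. Velocity: $\mathfrak{V}_{\mathcal{R}}W(x,y)=\sum_{F,H}\sum_{a\ne b}\mathcal{R}_{F,H}t^{x,y}_{\mathrm{ind}}(F^{a,b},W)(\mathbb{1}[ab\in E(H)\setminus E(F)]-\mathbb{1}[ab\in E(F)\setminus E(H)])$. For a graphon $W$ the trajectory $t\mapsto\Phi^tW$, $t\ge0$, is the unique solution of $\frac{d}{dt}\Phi^tW=\mathfrak{V}_{\mathcal{R}}(\Phi^tW)$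 in $(\mathcal{W},\|\cdot\|_\infty)$, $\Phi^0W=W$; $\mathrm{dest}(W)$ is the graphon $S$ (if it exists) with $d_\square(\Phi^tW,S)\to0$. The extremist rule of order $k$: $\mathcal{R}_{F,\overline{K_k}}=1$ if $e(F)<\frac12\binom k2$; $\mathcal{R}_{F,K_k}=1$ if $e(F)>\frac12\binom k2$; $\mathcal{R}_{F,F}=1$ if $e(F)=\frac12\binom k2$; other entries $0$. The density threshold of the extremist rule of order $k$ is $\theta(k):=\sup\{p\in[0,1]:\forall W\in\mathcal{W}_0,\ \|W\|_1\le p\Rightarrow\mathrm{dest}(W)=0\}$. *)

theory Defs
  imports "HOL-Probability.Probability"
begin

definition atomless :: "'a measure \<Rightarrow> bool" where
  "atomless M \<longleftrightarrow>
     (\<forall>A\<in>sets M. emeasure M A > 0 \<longrightarrow>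
        (\<exists>B\<in>sets M. B \<subseteq> A \<and> 0 < emeasure M B \<and> emeasure M B < emeasure M A))"

text \<open>Separability of the \<open>\<sigma>\<close>-algebra with respect to the pseudometric
  given by the measure of the symmetric difference.  Every countably generated
  \<open>\<sigma>\<close>-algebra has this property, and it is stable under completion.\<close>

definition separable_sigma_algebra :: "'a measure \<Rightarrow> bool" where
  "separable_sigma_algebra M \<longleftrightarrow>
     (\<exists>D. countable D \<and> D \<subseteq> sets M \<and>
        (\<forall>A\<in>sets M. \<forall>\<epsilon>>0. \<exists>B\<in>D. measure M ((A - B) \<union> (B - A)) < \<epsilon>))"

text \<open>Kernels are handled through representatives which are bounded and symmetric
  everywhere on the space; two kernels that agree almost everywhere are the same
  element of the Banach space of kernels.\<close>

definition kernel :: "'a measure \<Rightarrow> ('a \<times> 'a \<Rightarrow> real) \<Rightarrow> bool" where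
  "kernel M W \<longleftrightarrow>
     W \<in> borel_measurable (M \<Otimes>\<^sub>M M) \<and>
     (\<forall>x\<in>space M. \<forall>y\<in>space M. W (x, y) = W (y, x)) \<and>
     (\<exists>C. \<forall>x\<in>space M. \<forall>y\<in>space M. \<bar>W (x, y)\<bar> \<le> C)"

definition graphon :: "'a measure \<Rightarrow> ('a \<times> 'a \<Rightarrow> real) \<Rightarrow> bool" where
  "graphon M W \<longleftrightarrow>
     kernel M W \<and> (\<forall>x\<in>space M. \<forall>y\<in>space M. W (x, y) \<in> {0..1})"

definition norm_inf :: "'a measure \<Rightarrow> ('a \<times> 'a \<Rightarrow> real) \<Rightarrow> ereal" where
  "norm_inf M W = esssup (M \<Otimes>\<^sub>M M) (\<lambda>z. ereal \<bar>W z\<bar>)"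

definition norm_one :: "'a measure \<Rightarrow> ('a \<times> 'a \<Rightarrow> real) \<Rightarrow> real" where
  "norm_one M W = (\<integral>z. \<bar>W z\<bar> \<partial>(M \<Otimes>\<^sub>M M))"

definition cut_dist :: "'a measure \<Rightarrow> ('a \<times> 'a \<Rightarrow> real) \<Rightarrow> ('a \<times> 'a \<Rightarrow> real) \<Rightarrow> real" where
  "cut_dist M U W =
     (SUP (S, T)\<in>sets M \<times> sets M.
        \<bar>set_lebesgue_integral (M \<Otimes>\<^sub>M M) (S \<times> T) (\<lambda>z. U z - W z)\<bar>)"

text \<open>A graph on \<open>{1..k}\<close> is represented by its edge set.\<close>

type_synonym graph = "nat set set"

definition complete_graph_on :: "nat \<Rightarrow> graph" where
  "complete_graph_on k = {e. e \<subseteq> {1..k} \<and> card e = 2}"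

definition graphs_on :: "nat \<Rightarrow> graph set" where
  "graphs_on k = Pow (complete_graph_on k)"

definition flip_rule :: "nat \<Rightarrow> (graph \<Rightarrow> graph \<Rightarrow> real) \<Rightarrow> bool" where
  "flip_rule k R \<longleftrightarrow>
     (\<forall>F\<in>graphs_on k. (\<forall>H\<in>graphs_on k. R F H \<in> {0..1}) \<and> (\<Sum>H\<in>graphs_on k. R F H) = 1)"

definition t_ind ::
  "'a measure \<Rightarrow> nat \<Rightarrow> graph \<Rightarrow> nat \<Rightarrow> nat \<Rightarrow> ('a \<times> 'a \<Rightarrow> real) \<Rightarrow> 'a \<Rightarrow> 'a \<Rightarrow> real" where
  "t_ind M k F a b W x y =
     (\<integral>z. (let v = z(a := x, b := y) in
          (\<Prod>(i, j)\<in>{(i, j). i \<in> {1..k} \<and> j \<in> {1..k} \<and> i < j \<and> {i, j} \<in> F}.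
             W (v i, v j)) *
          (\<Prod>(i, j)\<in>{(i, j). i \<in> {1..k} \<and> j \<in> {1..k} \<and> i < j \<and> {i, j} \<notin> F}.
             1 - W (v i, v j)))
        \<partial>(\<Pi>\<^sub>M i\<in>{1..k} - {a, b}. M))"

definition velocity ::
  "'a measure \<Rightarrow> nat \<Rightarrow> (graph \<Rightarrow> graph \<Rightarrow> real) \<Rightarrow> ('a \<times> 'a \<Rightarrow> real) \<Rightarrow> 'a \<times> 'a \<Rightarrow> real" where
  "velocity M k R W = (\<lambda>(x, y).
     \<Sum>F\<in>graphs_on k. \<Sum>H\<in>graphs_on k.
       \<Sum>(a, b)\<in>{(a, b). a \<in> {1..k} \<and> b \<in> {1..k} \<and> a \<noteq> b}.
         R F H * t_ind M k F a b W x y *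
         (of_bool ({a, b} \<in> H - F) - of_bool ({a, b} \<in> F - H)))"

text \<open>Solutions on \<open>[0, \<infinity>)\<close> of the differential equation; at time 0 the derivative
  is one-sided.  Being equations in the Banach space of kernels, both the initial
  condition and the derivative are understood up to null sets, so that a trajectory
  is determined up to the choice of representatives.\<close>

definition trajectory ::
  "'a measure \<Rightarrow> nat \<Rightarrow> (graph \<Rightarrow> graph \<Rightarrow> real) \<Rightarrow> ('a \<times> 'a \<Rightarrow> real) \<Rightarrow>
     (real \<Rightarrow> 'a \<times> 'a \<Rightarrow> real) \<Rightarrow> bool" where
  "trajectory M k R W \<Phi> \<longleftrightarrow>
     (\<forall>t\<ge>0. kernel M (\<Phi> t)) \<and>
     (AE z in M \<Otimes>\<^sub>M M. \<Phi> 0 z = W z) \<and>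
     (\<forall>t\<ge>0. ((\<lambda>h. norm_inf M (\<lambda>z. (\<Phi> (t + h) z - \<Phi> t z) / h - velocity M k R (\<Phi> t) z))
               \<longlongrightarrow> 0) (at 0 within {-t..}))"

text \<open>\<open>is_dest M k R W S\<close> stands for \<open>dest(W) = S\<close>.  The destination is unique only up to
  null sets, hence a relation.\<close>

definition is_dest ::
  "'a measure \<Rightarrow> nat \<Rightarrow> (graph \<Rightarrow> graph \<Rightarrow> real) \<Rightarrow> ('a \<times> 'a \<Rightarrow> real) \<Rightarrow>
     ('a \<times> 'a \<Rightarrow> real) \<Rightarrow> bool" where
  "is_dest M k R W S \<longleftrightarrow>
     graphon M S \<and>
     (\<exists>\<Phi>. trajectory M k R W \<Phi> \<and> ((\<lambda>t. cut_dist M (\<Phi> t) S) \<longlongrightarrow> 0) at_top)"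

definition extremist_rule :: "nat \<Rightarrow> graph \<Rightarrow> graph \<Rightarrow> real" where
  "extremist_rule k F H =
     (if real (card F) < 1 / 2 * real (k choose 2) then of_bool (H = {})
      else if real (card F) > 1 / 2 * real (k choose 2) then of_bool (H = complete_graph_on k)
      else of_bool (H = F))"

definition density_threshold :: "'a measure \<Rightarrow> nat \<Rightarrow> real" where
  "density_threshold M k =
     Sup {p \<in> {0..1}. \<forall>W. graphon M W \<longrightarrow> norm_one M W \<le> p \<longrightarrow>
            is_dest M k (extremist_rule k) W (\<lambda>_. 0)}"

lemma finite_graphs_on: "finite (graphs_on k)"
proof -
  have "complete_graph_on k \<subseteq> Pow {1..k}"
    by (auto simp: complete_graph_on_def)
  then show ?thesis
    unfolding graphs_on_def by (meson finite_Pow_iff finite_atLeastAtMost finite_subset)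
qed

lemma flip_rule_extremist: "flip_rule k (extremist_rule k)"
proof -
  have s: "(\<Sum>H\<in>graphs_on k. of_bool (H = G)) = (1::real)" if "G \<in> graphs_on k" for G
    using that finite_graphs_on[of k] by (simp add: of_bool_def)
  have "{} \<in> graphs_on k" "complete_graph_on k \<in> graphs_on k"
    by (auto simp: graphs_on_def)
  moreover have "extremist_rule k F =
      (\<lambda>H. of_bool (H = (if real (card F) < 1 / 2 * real (k choose 2) then {}
        else if real (card F) > 1 / 2 * real (k choose 2) then complete_graph_on k else F)))" for F
    by (simp add: extremist_rule_def fun_eq_iff)
  ultimately show ?thesis
    unfolding flip_rule_def by (auto intro!: s)
qed

end

theory Submission imports Defs begin

text \<open>
  Let \<open>A\<close> be a set of small positive measure and let \<open>W\<close> be \<open>1\<close> if one of the coordinates lies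
  in \<open>A\<close> and \<open>0\<close> otherwise.  If every pair meeting \<open>A\<close> is an edge, then a sample of \<open>k\<close> vertices
  that contains a vertex of \<open>A\<close> has at least \<open>k - 1\<close> edges, which for \<open>k \<le> 4\<close> is at least half
  of all pairs, so the extremist rule removes none of them.  Hence the velocity vanishes on
  \<open>A \<times> \<Omega>\<close>, and more precisely it is bounded there by the \<open>L\<^sup>1\<close>-size of \<open>1 - U\<close> on the
  corresponding row.  A Gronwall argument for \<open>\<integral>\<^bsub>A\<times>\<Omega>\<^esub> \<bar>1 - \<Phi>\<^sup>t W\<bar>\<close> shows that
  every trajectory of \<open>W\<close> stays \<open>1\<close> on \<open>A \<times> \<Omega>\<close>, so its cut distance to \<open>0\<close> is at least the
  measure of \<open>A\<close>.
\<close>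

section \<open>Linear growth from a zero\<close>

text \<open>A Gronwall argument that uses no derivative of \<open>m\<close>: on a short interval starting at a zero
  of \<open>m\<close>, the supremum of \<open>m\<close> is at most half of itself.\<close>

lemma zero_of_local_linear_growth:
  fixes m :: "real \<Rightarrow> real"
  assumes nonneg: "\<And>t. 0 \<le> m t" and zero: "m 0 = 0" and T: "0 \<le> T"
    and local: "\<And>x. 0 \<le> x \<Longrightarrow> \<exists>d>0. \<exists>B C. \<forall>s\<ge>0. \<bar>s - x\<bar> < d \<longrightarrow> m s \<le> B \<and>
      (\<forall>e>0. \<exists>\<eta>>0. \<forall>r\<ge>0. \<bar>r - s\<bar> < \<eta> \<longrightarrow> \<bar>m r - m s\<bar> \<le> \<bar>r - s\<bar> * (C * m s + e))"
  shows "m T = 0"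
proof -
  \<comment> \<open>This is the interval predicate of the bisection read at \<open>a = 0\<close> and
    \<open>b = T\<close>, which explains the trivial first premise. That a zero at the left end
    forces one at the right end is transitive, so only short intervals around a point need
    work.\<close>
  have "0 \<le> (0::real) \<longrightarrow> m 0 = 0 \<longrightarrow> m T = 0"
    using T
  proof (induction rule: Bolzano[where P = "\<lambda>a b. 0 \<le> a \<longrightarrow> m a = 0 \<longrightarrow> m b = 0"])
    case (trans a b c)
    then show ?case by simp
  next
    case (local x)
    then obtain d B C0 where d: "d > 0" and
      dBC: "\<And>s. 0 \<le> s \<Longrightarrow> \<bar>s - x\<bar> < d \<Longrightarrow> m s \<le> B \<and>
      (\<forall>e>0. \<exists>\<eta>>0. \<forall>r\<ge>0. \<bar>r - s\<bar> < \<eta> \<longrightarrow> \<bar>m r - m s\<bar> \<le> \<bar>r - s\<bar> * (C0 * m s + e))"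
      using assms(4)[of x] by metis
    define C where "C = max C0 1"
    have C: "C \<ge> 1" "C \<ge> C0" by (auto simp: C_def)
    \<comment> \<open>A length below \<open>d\<close> makes the local hypothesis available on all of
      \<open>{a..b}\<close>; a length below \<open>1 / (2 * C)\<close> turns slope
      \<open>C * \<mu>\<close> into an increase of at most \<open>\<mu> / 2\<close>. Having
      \<open>C\<close> at least \<open>1\<close> keeps the allowed length positive.\<close>
    have "m b = 0" if ab: "a \<le> x" "x \<le> b" "b - a < min d (1 / (2 * C))" "0 \<le> a" "m a = 0" for a b
    proof -
      define \<mu> where "\<mu> = (SUP s\<in>{a..b}. m s)"
      have near: "\<bar>s - x\<bar> < d" if "s \<in> {a..b}" for s using that ab by auto
      have bdd: "bdd_above (m ` {a..b})"
        by (rule bdd_aboveI[of _ B]) (use dBC near ab in auto)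
      have m_le: "m s \<le> \<mu>" if "s \<in> {a..b}" for s
        unfolding \<mu>_def using bdd that by (rule cSUP_upper2) simp
      \<comment> \<open>A mean value inequality with one slope for the whole interval, obtained by a
        second bisection: the estimate at \<open>y\<close> is applied towards both ends of a short
        interval around \<open>y\<close>. The slack \<open>e\<close> disappears only when
        \<open>\<mu>\<close> is compared with half of itself.\<close>
      have lip: "\<bar>m r - m s\<bar> \<le> (C * \<mu> + e) * (r - s)"
        if "a \<le> s" "s \<le> r" "r \<le> b" "e > 0" for s r e
      proof -
        have "a \<le> s \<and> r \<le> b \<longrightarrow> \<bar>m r - m s\<bar> \<le> (C * \<mu> + e) * (r - s)"
          using \<open>s \<le> r\<close>
        proof (induction rule: Bolzano[where P = "\<lambda>s r. a \<le> s \<and> r \<le> b \<longrightarrow> \<bar>m r - m s\<bar> \<le> (C * \<mu> + e) * (r - s)"])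
          case (trans u v w)
          then show ?case by (auto simp: algebra_simps)
        next
          case (local y)
          then have y: "y \<in> {a..b}" "0 \<le> y" using that ab by auto
          obtain \<eta> where \<eta>: "\<eta> > 0"
            "\<And>r. 0 \<le> r \<Longrightarrow> \<bar>r - y\<bar> < \<eta> \<Longrightarrow> \<bar>m r - m y\<bar> \<le> \<bar>r - y\<bar> * (C0 * m y + e)"
            using dBC[OF y(2) near[OF y(1)]] \<open>e > 0\<close> by metis
          have le: "C0 * m y + e \<le> C * \<mu> + e"
            using mult_mono[OF C(2) m_le[OF y(1)]] C nonneg[of y] by auto
          have step: "\<bar>m r - m y\<bar> \<le> \<bar>r - y\<bar> * (C * \<mu> + e)" if "0 \<le> r" "\<bar>r - y\<bar> < \<eta>" for r
            using \<eta>(2)[OF that] mult_left_mono[OF le, of "\<bar>r - y\<bar>"] by linarith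
          have "\<bar>m v - m u\<bar> \<le> (C * \<mu> + e) * (v - u)"
            if "u \<le> y" "y \<le> v" "v - u < \<eta>" "a \<le> u" for u v
          proof -
            have "\<bar>m v - m u\<bar> \<le> \<bar>m v - m y\<bar> + \<bar>m u - m y\<bar>" by linarith
            also have "\<dots> \<le> (v - y) * (C * \<mu> + e) + (y - u) * (C * \<mu> + e)"
              using step[of v] step[of u] that ab by (intro add_mono) auto
            finally show ?thesis by (simp add: algebra_simps)
          qed
          with \<eta>(1) show ?case by blast
        qed
        then show ?thesis using that by simp
      qed
      have \<mu>0: "0 \<le> \<mu>" using m_le[of a] nonneg[of a] ab by auto
      have "m s \<le> (C * \<mu> + e) * (1 / (2 * C))" if s: "s \<in> {a..b}" and "e > 0" for s e
      proof -
        have "m s \<le> (C * \<mu> + e) * (s - a)" using lip[of a s e] s \<open>e > 0\<close> ab by auto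
        also have "\<dots> \<le> (C * \<mu> + e) * (1 / (2 * C))"
          using s ab \<open>e > 0\<close> \<mu>0 C by (intro mult_left_mono) auto
        finally show ?thesis .
      qed
      then have *: "\<mu> \<le> (C * \<mu> + e) * (1 / (2 * C))" if "e > 0" for e
        unfolding \<mu>_def[symmetric] using that ab by (subst \<mu>_def, intro cSUP_least) auto
      have "\<mu> \<le> e" if "e > 0" for e
      proof -
        have "(C * \<mu> + e) * (1 / (2 * C)) = \<mu> / 2 + e / (2 * C)" using C by (simp add: field_simps)
        moreover have "e / (2 * C) \<le> e / 2"
          using C that by (intro divide_left_mono) auto
        ultimately show ?thesis using * that by fastforce
      qed
      then have "\<mu> \<le> 0" using field_le_epsilon[of \<mu> 0] by auto
      then show ?thesis using m_le[of b] nonneg[of b] ab by auto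
    qed
    then show ?case
      using d C by (intro exI[of _ "min d (1 / (2 * C))"]) auto
  qed
  then show ?thesis using zero by simp
qed

section \<open>Small sets in atomless spaces\<close>

text \<open>Atomlessness splits \<open>A\<close> into two parts of positive measure, and one of them
  has at most half the measure of \<open>A\<close>. Iterating the halving goes below any
  \<open>e\<close>.\<close>

lemma exists_small_positive_set:
  assumes "prob_space M" "atomless M" "e > 0"
  shows "\<exists>A\<in>sets M. 0 < measure M A \<and> measure M A < e"
proof -
  interpret prob_space M by fact
  have "\<exists>A\<in>sets M. 0 < measure M A \<and> measure M A \<le> (1/2) ^ n" for n
  proof (induction n)
    case 0
    show ?case by (rule bexI[of _ "space M"]) (auto simp: prob_space)
  next
    case (Suc n)
    then obtain A where A: "A \<in> sets M" "0 < measure M A" "measure M A \<le> (1/2) ^ n" by auto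
    then obtain B where B: "B \<in> sets M" "B \<subseteq> A" "0 < measure M B" "measure M B < measure M A"
      using \<open>atomless M\<close> unfolding atomless_def
      by (auto simp: emeasure_eq_measure ennreal_less_iff)
    have "measure M (A - B) = measure M A - measure M B"
      using A B by (simp add: finite_measure_Diff)
    then show ?case
      using A B by (cases "measure M B \<le> measure M A / 2")
        (fastforce intro: bexI[of _ B], fastforce intro!: bexI[of _ "A - B"])
  qed
  moreover obtain n where "(1/2::real) ^ n < e"
    using real_arch_pow_inv[OF \<open>e > 0\<close>, of "1/2"] by auto
  ultimately show ?thesis by (meson le_less_trans)
qed

section \<open>Null sets of pairs and sampled tuples\<close>

text \<open>Rectangles determine the product measure, and the preimage of a rectangle is a cylinder
  over two distinct coordinates. This carries null sets of pairs over to sampled tuples.\<close>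

lemma distr_PiM_two_components:
  assumes "prob_space M" "i \<in> I" "j \<in> I" "i \<noteq> j"
  shows "distr (PiM I (\<lambda>_. M)) (M \<Otimes>\<^sub>M M) (\<lambda>z. (z i, z j)) = M \<Otimes>\<^sub>M M"
proof -
  interpret prob_space M by fact
  have [measurable]: "(\<lambda>z. (z i, z j)) \<in> PiM I (\<lambda>_. M) \<rightarrow>\<^sub>M M \<Otimes>\<^sub>M M"
    using assms by measurable
  show ?thesis
  proof (rule pair_measure_eqI[symmetric])
    show "emeasure M A * emeasure M B
        = emeasure (distr (PiM I (\<lambda>_. M)) (M \<Otimes>\<^sub>M M) (\<lambda>z. (z i, z j))) (A \<times> B)"
      if AB: "A \<in> sets M" "B \<in> sets M" for A B
    proof -
      have "(\<lambda>z. (z i, z j)) -` (A \<times> B) \<inter> space (PiM I (\<lambda>_. M))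
          = prod_emb I (\<lambda>_. M) {i, j} (\<Pi>\<^sub>E l\<in>{i, j}. if l = i then A else B)"
        using assms by (auto simp: prod_emb_def space_PiM PiE_iff)
      moreover have "emeasure (PiM I (\<lambda>_. M)) (prod_emb I (\<lambda>_. M) {i, j} (\<Pi>\<^sub>E l\<in>{i, j}. if l = i then A else B))
          = (\<Prod>l\<in>{i, j}. emeasure M (if l = i then A else B))"
        using assms AB by (intro emeasure_PiM_emb) auto
      ultimately show ?thesis
        using assms AB by (simp add: emeasure_distr)
    qed
  qed (auto intro: sigma_finite_measure_axioms)
qed

lemma AE_PiM_two_components:
  assumes "prob_space M" "i \<in> I" "j \<in> I" "i \<noteq> j" "AE w in M \<Otimes>\<^sub>M M. P w"
  shows "AE z in PiM I (\<lambda>_. M). P (z i, z j)"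
proof -
  have "(\<lambda>z. (z i, z j)) \<in> PiM I (\<lambda>_. M) \<rightarrow>\<^sub>M M \<Otimes>\<^sub>M M"
    using assms by measurable
  moreover have "AE w in distr (PiM I (\<lambda>_. M)) (M \<Otimes>\<^sub>M M) (\<lambda>z. (z i, z j)). P w"
    unfolding distr_PiM_two_components[OF assms(1-4)] by fact
  ultimately show ?thesis by (rule AE_distrD)
qed

lemma
  assumes "prob_space M" "AE x in M. P x"
  shows AE_pair_fst: "AE w in M \<Otimes>\<^sub>M M. P (fst w)"
    and AE_pair_snd: "AE w in M \<Otimes>\<^sub>M M. P (snd w)"
proof -
  interpret prob_space M by fact
  obtain N where N: "{x \<in> space M. \<not> P x} \<subseteq> N" "emeasure M N = 0" "N \<in> sets M"
    using AE_E[OF assms(2)] .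
  have "emeasure (M \<Otimes>\<^sub>M M) (N \<times> space M) = 0" "emeasure (M \<Otimes>\<^sub>M M) (space M \<times> N) = 0"
    using N by (simp_all add: emeasure_pair_measure_Times)
  moreover have "N \<times> space M \<in> sets (M \<Otimes>\<^sub>M M)" "space M \<times> N \<in> sets (M \<Otimes>\<^sub>M M)"
    using N by auto
  moreover have "{w \<in> space (M \<Otimes>\<^sub>M M). \<not> P (fst w)} \<subseteq> N \<times> space M"
    "{w \<in> space (M \<Otimes>\<^sub>M M). \<not> P (snd w)} \<subseteq> space M \<times> N"
    using N by (auto simp: space_pair_measure)
  ultimately show "AE w in M \<Otimes>\<^sub>M M. P (fst w)" "AE w in M \<Otimes>\<^sub>M M. P (snd w)"
    by (blast intro: AE_I)+
qed

text \<open>Along a trajectory the bounds that hold everywhere may depend badly on the representatives;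
  only essential bounds are locally uniform in time, so the estimates below start from those.\<close>

lemma AE_kernel_bound_at_tuple:
  assumes M: "prob_space M" and U: "kernel M U" and B: "AE w in M \<Otimes>\<^sub>M M. \<bar>U w\<bar> \<le> B"
    and ij: "i \<in> {1..k}" "j \<in> {1..k}" "i \<noteq> j"
  shows "AE w in M \<Otimes>\<^sub>M M. AE z in PiM ({1..k} - {a, b}) (\<lambda>_. M).
    \<bar>U ((z(a := fst w, b := snd w)) i, (z(a := fst w, b := snd w)) j)\<bar> \<le> B"
proof -
  interpret prob_space M by fact
  interpret pair_prob_space M M ..
  let ?I = "{1..k} - {a, b}"
  let ?P = "PiM ?I (\<lambda>_. M)"
  have sp: "z l \<in> space M" if "z \<in> space ?P" "l \<in> ?I" for z l
    using that by (auto simp: space_PiM PiE_iff)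
  have sym: "U (x, y) = U (y, x)" if "x \<in> space M" "y \<in> space M" for x y
    using U that by (auto simp: kernel_def)
  have row: "AE x in M. AE y in M. \<bar>U (x, y)\<bar> \<le> B"
    using AE_pair[OF B] .
  have row': "AE x in M. x \<in> space M \<longrightarrow> (AE z in ?P. \<bar>U (x, z l)\<bar> \<le> B \<and> \<bar>U (z l, x)\<bar> \<le> B)"
    if l: "l \<in> ?I" for l
    using row
  proof eventually_elim
    case (elim x)
    have "AE z in ?P. \<bar>U (x, z l)\<bar> \<le> B"
      using l elim AE_PiM_component[of ?I "\<lambda>_. M" l "\<lambda>y. \<bar>U (x, y)\<bar> \<le> B"] M by simp
    then have "AE z in ?P. \<bar>U (x, z l)\<bar> \<le> B \<and> \<bar>U (z l, x)\<bar> \<le> B" if "x \<in> space M"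
      using AE_space[of ?P] by (rule eventually_elim2) (use that sym sp[OF _ l] in auto)
    then show ?case by simp
  qed
  note 1 = AE_pair_fst[OF M row'] AE_pair_snd[OF M row']
  \<comment> \<open>The pair is the fixed one, consists of two sampled vertices, or mixes a fixed
    and a sampled vertex; the mixed cases need the row-wise bound. For \<open>a = b\<close> the
    later update wins and the slot carries \<open>snd w\<close>, so the cases reading
    \<open>fst w\<close> require \<open>a \<noteq> b\<close>.\<close>
  consider "{i, j} = {a, b}" | "i \<in> ?I" "j \<in> ?I" | "i \<in> ?I" "j = a" "a \<noteq> b"| "i \<in> ?I" "j = b"
    | "j \<in> ?I" "i = a" "a \<noteq> b" | "j \<in> ?I" "i = b"
    using ij by (cases "i = a"; cases "j = a"; cases "i = b"; cases "j = b") auto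
  then show ?thesis
  proof cases
    case 1
    then have "i = a \<and> j = b \<or> i = b \<and> j = a" by (auto simp: doubleton_eq_iff)
    then show ?thesis using ij
      by (intro eventually_elim2[OF B AE_space[of "M \<Otimes>\<^sub>M M"]])
        (auto simp: space_pair_measure sym)
  next
    case 2
    have "AE z in ?P. \<bar>U (z i, z j)\<bar> \<le> B"
      using AE_PiM_two_components[OF M 2 ij(3) B] .
    then show ?thesis using 2 by simp
  next
    case 3
    show ?thesis using 1(1)[OF 3(1)] AE_space[of "M \<Otimes>\<^sub>M M"]
      by (rule eventually_elim2) (use 3 in \<open>auto simp: space_pair_measure\<close>)
  next
    case 4
    show ?thesis using 1(2)[OF 4(1)] AE_space[of "M \<Otimes>\<^sub>M M"]
      by (rule eventually_elim2) (use 4 in \<open>auto simp: space_pair_measure\<close>)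
  next
    case 5
    show ?thesis using 1(1)[OF 5(1)] AE_space[of "M \<Otimes>\<^sub>M M"]
      by (rule eventually_elim2) (use 5 in \<open>auto simp: space_pair_measure\<close>)
  next
    case 6
    show ?thesis using 1(2)[OF 6(1)] AE_space[of "M \<Otimes>\<^sub>M M"]
      by (rule eventually_elim2) (use 6 in \<open>auto simp: space_pair_measure\<close>)
  qed
qed

section \<open>Bounds on induced densities\<close>

definition ind_density_integrand :: "nat \<Rightarrow> graph \<Rightarrow> ('a \<times> 'a \<Rightarrow> real) \<Rightarrow> (nat \<Rightarrow> 'a) \<Rightarrow> real" where
  "ind_density_integrand k F W v =
    (\<Prod>(i, j)\<in>{(i, j). i \<in> {1..k} \<and> j \<in> {1..k} \<and> i < j \<and> {i, j} \<in> F}. W (v i, v j)) *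
    (\<Prod>(i, j)\<in>{(i, j). i \<in> {1..k} \<and> j \<in> {1..k} \<and> i < j \<and> {i, j} \<notin> F}. 1 - W (v i, v j))"

lemma t_ind_eq:
  "t_ind M k F a b W x y =
    (\<integral>z. ind_density_integrand k F W (z(a := x, b := y)) \<partial>PiM ({1..k} - {a, b}) (\<lambda>_. M))"
  by (simp add: t_ind_def ind_density_integrand_def Let_def)

lemma abs_prod_le_power:
  fixes f :: "'i \<Rightarrow> real"
  assumes "\<And>i. i \<in> I \<Longrightarrow> \<bar>f i\<bar> \<le> K" "1 \<le> K" "card I \<le> n"
  shows "\<bar>\<Prod>i\<in>I. f i\<bar> \<le> K ^ n"
proof -
  have "\<bar>\<Prod>i\<in>I. f i\<bar> \<le> (\<Prod>i\<in>I. K)"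
    unfolding abs_prod using assms by (intro prod_mono) auto
  also have "\<dots> \<le> K ^ n" using assms by (simp add: power_increasing)
  finally show ?thesis .
qed

text \<open>The factor belonging to the nonedge \<open>pq\<close> is pulled out. Every other factor
  is at most \<open>1 + B\<close> in absolute value, and each of the two products has at most
  \<open>k * k\<close> factors, whence the exponent. Linearity in the distance of \<open>W\<close>
  from \<open>1\<close> is what the growth estimate requires.\<close>

lemma ind_density_integrand_bound:
  assumes pq: "p \<in> {1..k}" "q \<in> {1..k}" "p \<noteq> q" "{p, q} \<notin> F" and B: "0 \<le> B"
    and bound: "\<And>i j. i \<in> {1..k} \<Longrightarrow> j \<in> {1..k} \<Longrightarrow> i \<noteq> j \<Longrightarrow> \<bar>W (v i, v j)\<bar> \<le> B"
    and sym: "W (v p, v q) = W (v q, v p)"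
  shows "\<bar>ind_density_integrand k F W v\<bar> \<le> (1 + B) ^ (2 * k\<^sup>2) * \<bar>1 - W (v p, v q)\<bar>"
proof -
  define E where "E = {(i, j). i \<in> {1..k} \<and> j \<in> {1..k} \<and> i < j \<and> {i, j} \<in> F}"
  define N where "N = {(i, j). i \<in> {1..k} \<and> j \<in> {1..k} \<and> i < j \<and> {i, j} \<notin> F}"
  have sub: "E \<subseteq> {1..k} \<times> {1..k}" "N \<subseteq> {1..k} \<times> {1..k}" by (auto simp: E_def N_def)
  have card: "card S \<le> k\<^sup>2" if "S \<subseteq> {1..k} \<times> {1..k}" for S
    using card_mono[OF _ that] by (simp add: power2_eq_square)
  have fin: "finite N" using sub finite_subset by blast
  \<comment> \<open>The products run over increasing pairs, so the nonedge has to be ordered first;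
    \<open>sym\<close> covers the case where this swaps \<open>p\<close> and
    \<open>q\<close>.\<close>
  define r where "r = (min p q, max p q)"
  have r: "r \<in> N" using pq by (auto simp: N_def r_def min_def max_def insert_commute)
  have Wr: "(case r of (i, j) \<Rightarrow> 1 - W (v i, v j)) = 1 - W (v p, v q)"
    using sym by (auto simp: r_def min_def max_def)
  have split: "ind_density_integrand k F W v =
      (\<Prod>(i, j)\<in>E. W (v i, v j)) * ((\<Prod>(i, j)\<in>N - {r}. 1 - W (v i, v j)) * (1 - W (v p, v q)))"
    unfolding ind_density_integrand_def E_def[symmetric] N_def[symmetric]
    using prod.remove[OF fin r, of "\<lambda>(i, j). 1 - W (v i, v j)"] Wr by (simp add: mult.commute)
  have 1: "\<bar>\<Prod>(i, j)\<in>E. W (v i, v j)\<bar> \<le> (1 + B) ^ k\<^sup>2"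
  proof (rule abs_prod_le_power)
    fix e assume "e \<in> E"
    then show "\<bar>case e of (i, j) \<Rightarrow> W (v i, v j)\<bar> \<le> 1 + B"
      using bound[of "fst e" "snd e"] by (auto simp: E_def)
  qed (use B card sub in auto)
  have 2: "\<bar>\<Prod>(i, j)\<in>N - {r}. 1 - W (v i, v j)\<bar> \<le> (1 + B) ^ k\<^sup>2"
  proof (rule abs_prod_le_power)
    fix e assume "e \<in> N - {r}"
    then show "\<bar>case e of (i, j) \<Rightarrow> 1 - W (v i, v j)\<bar> \<le> 1 + B"
      using bound[of "fst e" "snd e"] by (auto simp: N_def)
  qed (use B sub in \<open>auto intro!: card\<close>)
  have "\<bar>ind_density_integrand k F W v\<bar> \<le> (1 + B) ^ k\<^sup>2 * ((1 + B) ^ k\<^sup>2 * \<bar>1 - W (v p, v q)\<bar>)"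
    unfolding split abs_mult using 1 2 B by (intro mult_mono) auto
  then show ?thesis by (simp add: mult_2 power_add)
qed

lemma integrable_kernel:
  assumes "prob_space M" "kernel M U"
  shows "integrable (M \<Otimes>\<^sub>M M) U"
proof -
  interpret prob_space M by fact
  interpret pair_prob_space M M ..
  obtain C where "\<forall>x\<in>space M. \<forall>y\<in>space M. \<bar>U (x, y)\<bar> \<le> C" "U \<in> borel_measurable (M \<Otimes>\<^sub>M M)"
    using assms by (auto simp: kernel_def)
  then show ?thesis
    by (intro P.integrable_const_bound[of _ C]) (auto simp: space_pair_measure)
qed

lemma integrable_kernel_row:
  assumes "prob_space M" "kernel M U" "x \<in> space M"
  shows "integrable M (\<lambda>y. U (x, y))"
proof -
  interpret prob_space M by fact
  obtain C where "\<forall>x\<in>space M. \<forall>y\<in>space M. \<bar>U (x, y)\<bar> \<le> C" and [measurable]: "U \<in> borel_measurable (M \<Otimes>\<^sub>M M)"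
    using assms by (auto simp: kernel_def)
  then show ?thesis
    using assms(3) by (intro integrable_const_bound[of _ C]) auto
qed

text \<open>If \<open>ab\<close> itself is a nonedge, the small factor depends on fixed vertices
  only and leaves the integral. If \<open>ac\<close> is one with \<open>c\<close> sampled,
  integrating over \<open>c\<close> turns the factor into the average of the distance from
  \<open>1\<close> along the row of \<open>fst w\<close>.\<close>

lemma
  assumes M: "prob_space M" and U: "kernel M U" and B: "AE w in M \<Otimes>\<^sub>M M. \<bar>U w\<bar> \<le> B" "0 \<le> B"
    and ab: "a \<in> {1..k}" "b \<in> {1..k}" "a \<noteq> b"
  shows t_ind_bound_nonedge: "{a, b} \<notin> F \<Longrightarrow> AE w in M \<Otimes>\<^sub>M M.
      \<bar>t_ind M k F a b U (fst w) (snd w)\<bar> \<le> (1 + B) ^ (2 * k\<^sup>2) * \<bar>1 - U w\<bar>"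
    and t_ind_bound_missing_edge: "c \<in> {1..k} - {a, b} \<Longrightarrow> {a, c} \<notin> F \<Longrightarrow> AE w in M \<Otimes>\<^sub>M M.
      \<bar>t_ind M k F a b U (fst w) (snd w)\<bar> \<le> (1 + B) ^ (2 * k\<^sup>2) * (\<integral>z. \<bar>1 - U (fst w, z)\<bar> \<partial>M)"
proof -
  interpret prob_space M by fact
  let ?I = "{1..k} - {a, b}"
  let ?P = "PiM ?I (\<lambda>_. M)"
  let ?K = "(1 + B) ^ (2 * k\<^sup>2)"
  interpret P: prob_space ?P by (rule prob_space_PiM) (rule M)
  have sym: "U (x, y) = U (y, x)" if "x \<in> space M" "y \<in> space M" for x y
    using U that by (auto simp: kernel_def)
  define v where "v w z = z(a := fst w, b := snd w)" for w :: "'a \<times> 'a" and z :: "nat \<Rightarrow> 'a"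
  have v_space: "v w z i \<in> space M" if "w \<in> space (M \<Otimes>\<^sub>M M)" "z \<in> space ?P" "i \<in> {1..k}" for w z i
    using that by (auto simp: v_def space_PiM PiE_iff space_pair_measure)
  have "AE w in M \<Otimes>\<^sub>M M. AE z in ?P. \<forall>p\<in>{(i, j). i \<in> {1..k} \<and> j \<in> {1..k} \<and> i \<noteq> j}.
      \<bar>U (v w z (fst p), v w z (snd p))\<bar> \<le> B"
  proof -
    have fin: "finite {(i, j). i \<in> {1..k} \<and> j \<in> {1..k} \<and> i \<noteq> j}"
      by (rule finite_subset[of _ "{1..k} \<times> {1..k}"]) auto
    have "AE w in M \<Otimes>\<^sub>M M. \<forall>p\<in>{(i, j). i \<in> {1..k} \<and> j \<in> {1..k} \<and> i \<noteq> j}.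
        AE z in ?P. \<bar>U (v w z (fst p), v w z (snd p))\<bar> \<le> B"
      unfolding v_def
      by (rule AE_finite_allI[OF fin], rule AE_kernel_bound_at_tuple[OF M U B(1)]) auto
    then show ?thesis
      by eventually_elim (rule AE_finite_allI[OF fin], blast)
  qed
  \<comment> \<open>Both bounds are instances of this one for an arbitrary nonedge
    \<open>pq\<close>: first with \<open>q = b\<close>, then with \<open>q = c\<close>, each time
    with \<open>p = a\<close>.\<close>
  then have main: "AE w in M \<Otimes>\<^sub>M M. \<forall>p q. p \<in> {1..k} \<longrightarrow> q \<in> {1..k} \<longrightarrow> p \<noteq> q \<longrightarrow> {p, q} \<notin> F \<longrightarrow>
      integrable ?P (\<lambda>z. \<bar>1 - U (v w z p, v w z q)\<bar>) \<longrightarrow>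
      \<bar>t_ind M k F a b U (fst w) (snd w)\<bar> \<le> ?K * (\<integral>z. \<bar>1 - U (v w z p, v w z q)\<bar> \<partial>?P)" for F
    using AE_space
  proof eventually_elim
    case (elim w)
    show ?case
    proof (intro allI impI)
      fix p q assume pq: "p \<in> {1..k}" "q \<in> {1..k}" "p \<noteq> q" "{p, q} \<notin> F"
        "integrable ?P (\<lambda>z. \<bar>1 - U (v w z p, v w z q)\<bar>)"
      have "AE z in ?P. \<bar>ind_density_integrand k F U (v w z)\<bar> \<le> ?K * \<bar>1 - U (v w z p, v w z q)\<bar>"
        using elim(1) AE_space
      proof eventually_elim
        case (elim z)
        then show ?case
          using pq B(2) \<open>w \<in> space (M \<Otimes>\<^sub>M M)\<close>
          by (intro ind_density_integrand_bound sym v_space) auto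
      qed
      then have "(\<integral>z. \<bar>ind_density_integrand k F U (v w z)\<bar> \<partial>?P)
          \<le> (\<integral>z. ?K * \<bar>1 - U (v w z p, v w z q)\<bar> \<partial>?P)"
        using pq(5) B(2) by (intro integral_mono_AE') auto
      moreover have "\<bar>t_ind M k F a b U (fst w) (snd w)\<bar>
          \<le> (\<integral>z. \<bar>ind_density_integrand k F U (v w z)\<bar> \<partial>?P)"
        unfolding t_ind_eq v_def by (rule integral_abs_bound)
      ultimately show "\<bar>t_ind M k F a b U (fst w) (snd w)\<bar> \<le> ?K * (\<integral>z. \<bar>1 - U (v w z p, v w z q)\<bar> \<partial>?P)"
        by simp
    qed
  qed
  show "AE w in M \<Otimes>\<^sub>M M. \<bar>t_ind M k F a b U (fst w) (snd w)\<bar> \<le> ?K * \<bar>1 - U w\<bar>" if "{a, b} \<notin> F"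
    using main[of F]
  proof eventually_elim
    case (elim w)
    have "v w z a = fst w" "v w z b = snd w" for z using ab by (auto simp: v_def)
    then show ?case using elim[rule_format, of a b] ab that
      by (simp add: P.prob_space del: One_nat_def)
  qed
  show "AE w in M \<Otimes>\<^sub>M M.
      \<bar>t_ind M k F a b U (fst w) (snd w)\<bar> \<le> ?K * (\<integral>z. \<bar>1 - U (fst w, z)\<bar> \<partial>M)"
    if c: "c \<in> {1..k} - {a, b}" "{a, c} \<notin> F"
    using main[of F] AE_space
  proof eventually_elim
    case (elim w)
    then have x: "fst w \<in> space M" by (auto simp: space_pair_measure)
    have v: "v w z a = fst w" "v w z c = z c" for z using ab c by (auto simp: v_def)
    have int: "integrable M (\<lambda>z. \<bar>1 - U (fst w, z)\<bar>)"
      using integrable_kernel_row[OF M U x] by auto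
    have comp: "(\<lambda>z. z c) \<in> ?P \<rightarrow>\<^sub>M M" using c by measurable
    have D: "distr ?P M (\<lambda>z. z c) = M"
      by (rule distr_PiM_component[of ?I "\<lambda>_. M" c]) (use M c in auto)
    have "integrable ?P (\<lambda>z. \<bar>1 - U (fst w, z c)\<bar>)"
      using integrable_distr[OF comp, of "\<lambda>z. \<bar>1 - U (fst w, z)\<bar>"] int unfolding D by simp
    moreover have "(\<integral>z. \<bar>1 - U (fst w, z c)\<bar> \<partial>?P) = (\<integral>z. \<bar>1 - U (fst w, z)\<bar> \<partial>M)"
      using integral_distr[OF comp, of "\<lambda>z. \<bar>1 - U (fst w, z)\<bar>"] int unfolding D
      by (simp add: borel_measurable_integrable)
    ultimately show ?case using elim(1)[rule_format, of a c] ab c v by auto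
  qed
qed

section \<open>The velocity of the extremist rule\<close>

text \<open>There are \<open>k - 1\<close> possible edges at \<open>a\<close>, too many for all of
  them to lie in \<open>F\<close>.\<close>

lemma exists_missing_edge:
  assumes F: "F \<in> graphs_on k" and a: "a \<in> {1..k}" and card: "card F < k - 1"
  shows "\<exists>c\<in>{1..k} - {a}. {a, c} \<notin> F"
proof (rule ccontr)
  assume "\<not> ?thesis"
  then have "(\<lambda>c. {a, c}) ` ({1..k} - {a}) \<subseteq> F" by auto
  moreover have "finite F"
  proof (rule finite_subset)
    show "F \<subseteq> Pow {1..k}" using F by (auto simp: graphs_on_def complete_graph_on_def)
  qed simp
  moreover have "inj_on (\<lambda>c. {a, c}) ({1..k} - {a})"
    by (auto simp: inj_on_def doubleton_eq_iff)
  ultimately have "card ({1..k} - {a}) \<le> card F"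
    by (metis card_image card_mono)
  then show False using a card by simp
qed

text \<open>An edge \<open>ab\<close> is removed only if the sampled graph has fewer than half of all edges.  By the
  assumption on \<open>k\<close> it then has fewer than \<open>k - 1\<close> edges, so some edge at \<open>a\<close> is missing.\<close>

lemma velocity_bound:
  assumes M: "prob_space M" and U: "kernel M U" and B: "AE w in M \<Otimes>\<^sub>M M. \<bar>U w\<bar> \<le> B" "0 \<le> B"
    and k: "1 / 2 * real (k choose 2) \<le> real (k - 1)"
  shows "AE w in M \<Otimes>\<^sub>M M. \<bar>velocity M k (extremist_rule k) U w\<bar> \<le>
    (real (card (graphs_on k)))\<^sup>2 * real (card {(a, b). a \<in> {1..k} \<and> b \<in> {1..k} \<and> a \<noteq> b}) * (1 + B) ^ (2 * k\<^sup>2)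
    * (\<bar>1 - U w\<bar> + (\<integral>z. \<bar>1 - U (fst w, z)\<bar> \<partial>M))"
proof -
  let ?E = "{(a, b). a \<in> {1..k} \<and> b \<in> {1..k} \<and> a \<noteq> b}"
  let ?K = "(1 + B) ^ (2 * k\<^sup>2)"
  have fin: "finite ?E"
    by (rule finite_subset[of _ "{1..k} \<times> {1..k}"]) auto
  define row where "row w = (\<integral>z. \<bar>1 - U (fst w, z)\<bar> \<partial>M)" for w :: "'a \<times> 'a"
  have row0: "0 \<le> row w" for w by (simp add: row_def)
  define s where "s F H a b w = extremist_rule k F H * t_ind M k F a b U (fst w) (snd w) *
         (of_bool ({a, b} \<in> H - F) - of_bool ({a, b} \<in> F - H))" for F H a b w
  have bound: "AE w in M \<Otimes>\<^sub>M M. \<bar>s F H a b w\<bar> \<le> ?K * (\<bar>1 - U w\<bar> + row w)"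
    if F: "F \<in> graphs_on k" and ab: "a \<in> {1..k}" "b \<in> {1..k}" "a \<noteq> b" for F H a b
  proof -
    have le: "\<bar>s F H a b w\<bar> \<le> \<bar>t_ind M k F a b U (fst w) (snd w)\<bar>" for w
      by (auto simp: s_def extremist_rule_def abs_mult)
    \<comment> \<open>A nonedge \<open>ab\<close> contributes the pointwise term whatever the rule
      does. An edge \<open>ab\<close> can be lost only from a sparse \<open>F\<close>, which costs
      the row term; here \<open>c\<close> differs from \<open>b\<close> because \<open>ab\<close> is
      an edge. Otherwise \<open>F\<close> becomes complete or, in a tie, stays, and
      \<open>ab\<close> survives.\<close>
    consider (nonedge) "{a, b} \<notin> F" | (few) "{a, b} \<in> F" "real (card F) < 1 / 2 * real (k choose 2)"
      | (many) "{a, b} \<in> F" "\<not> real (card F) < 1 / 2 * real (k choose 2)" by blast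
    then show ?thesis
    proof cases
      case nonedge
      from t_ind_bound_nonedge[OF M U B ab this] show ?thesis
      proof eventually_elim
        case (elim w)
        have "?K * \<bar>1 - U w\<bar> \<le> ?K * (\<bar>1 - U w\<bar> + row w)"
          using row0 B by (intro mult_left_mono) auto
        then show ?case using elim le[of w] by linarith
      qed
    next
      case few
      then have "card F < k - 1" using k by linarith
      from exists_missing_edge[OF F ab(1) this] obtain c where "c \<in> {1..k} - {a}" "{a, c} \<notin> F"
        by blast
      with few(1) have c: "c \<in> {1..k} - {a, b}" "{a, c} \<notin> F" by auto
      from t_ind_bound_missing_edge[OF M U B ab c] show ?thesis
      proof eventually_elim
        case (elim w)
        have "?K * row w \<le> ?K * (\<bar>1 - U w\<bar> + row w)"
          using row0 B by (intro mult_left_mono) auto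
        then show ?case using elim le[of w] unfolding row_def by linarith
      qed
    next
      case many
      have "{a, b} \<in> complete_graph_on k" using ab by (auto simp: complete_graph_on_def)
      with many have "s F H a b w = 0" for w
        by (auto simp: s_def extremist_rule_def)
      then show ?thesis using row0 B by auto
    qed
  qed
  have "AE w in M \<Otimes>\<^sub>M M. \<forall>F\<in>graphs_on k. \<forall>H\<in>graphs_on k. \<forall>p\<in>?E.
      \<bar>s F H (fst p) (snd p) w\<bar> \<le> ?K * (\<bar>1 - U w\<bar> + row w)"
    by (intro AE_finite_allI finite_graphs_on fin bound) auto
  then show ?thesis
  proof eventually_elim
    case (elim w)
    have eq: "velocity M k (extremist_rule k) U w
        = (\<Sum>F\<in>graphs_on k. \<Sum>H\<in>graphs_on k. \<Sum>p\<in>?E. s F H (fst p) (snd p) w)"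
      by (simp add: velocity_def s_def case_prod_unfold)
    have "\<bar>velocity M k (extremist_rule k) U w\<bar>
        \<le> (\<Sum>F\<in>graphs_on k. \<Sum>H\<in>graphs_on k. \<Sum>p\<in>?E. ?K * (\<bar>1 - U w\<bar> + row w))"
      unfolding eq using elim
      by (intro order_trans[OF sum_abs] sum_mono) auto
    then show ?case by (simp add: power2_eq_square row_def mult.assoc)
  qed
qed

section \<open>First-order expansion of trajectories\<close>

text \<open>An essential supremum bounds its function almost everywhere, so the derivative in the
  norm becomes a first-order expansion outside a null set that may depend on
  \<open>r\<close>.\<close>

lemma trajectory_step:
  assumes "trajectory M k R W \<Phi>" "0 \<le> t" "0 < e"
  shows "\<exists>\<eta>>0. \<forall>r\<ge>0. \<bar>r - t\<bar> < \<eta> \<longrightarrow>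
    (AE w in M \<Otimes>\<^sub>M M. \<bar>\<Phi> r w - \<Phi> t w - (r - t) * velocity M k R (\<Phi> t) w\<bar> \<le> \<bar>r - t\<bar> * e)"
proof -
  let ?q = "\<lambda>h w. (\<Phi> (t + h) w - \<Phi> t w) / h - velocity M k R (\<Phi> t) w"
  have "((\<lambda>h. norm_inf M (?q h)) \<longlongrightarrow> 0) (at 0 within {-t..})"
    using assms by (auto simp: trajectory_def)
  then have "eventually (\<lambda>h. norm_inf M (?q h) < ereal e) (at 0 within {-t..})"
    by (rule order_tendstoD) (use assms in simp)
  then obtain \<eta> where \<eta>: "\<eta> > 0"
    "\<And>h. h \<in> {-t..} \<Longrightarrow> h \<noteq> 0 \<Longrightarrow> \<bar>h\<bar> < \<eta> \<Longrightarrow> norm_inf M (?q h) < ereal e"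
    unfolding eventually_at by auto
  have "AE w in M \<Otimes>\<^sub>M M. \<bar>\<Phi> r w - \<Phi> t w - (r - t) * velocity M k R (\<Phi> t) w\<bar> \<le> \<bar>r - t\<bar> * e"
    if r: "r \<ge> 0" "\<bar>r - t\<bar> < \<eta>" for r
  proof (cases "r = t")
    case False
    define h where "h = r - t"
    have h: "h \<noteq> 0" "r = t + h" "norm_inf M (?q h) < ereal e"
      using \<eta>(2)[of h] False r by (auto simp: h_def)
    have "AE w in M \<Otimes>\<^sub>M M. ereal \<bar>?q h w\<bar> \<le> norm_inf M (?q h)"
      unfolding norm_inf_def by (rule esssup_AE)
    then show ?thesis
    proof eventually_elim
      case (elim w)
      then have "ereal \<bar>?q h w\<bar> < ereal e" using h(3) by (rule le_less_trans)
      then have "\<bar>?q h w\<bar> \<le> e" by simp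
      then have "\<bar>h\<bar> * \<bar>?q h w\<bar> \<le> \<bar>h\<bar> * e" by (rule mult_left_mono) simp
      moreover have "h * ?q h w = \<Phi> r w - \<Phi> t w - h * velocity M k R (\<Phi> t) w"
        using h by (simp add: field_simps)
      ultimately show ?case by (simp add: abs_mult[symmetric] h_def)
    qed
  qed simp
  with \<eta>(1) show ?thesis by blast
qed

text \<open>Being a kernel bounds each \<open>\<Phi> s\<close> separately, not uniformly in
  \<open>s\<close>. Expanding at \<open>t\<close> with error constant \<open>1\<close> gives
  uniformity once the velocity at \<open>t\<close> is essentially bounded.\<close>

lemma trajectory_locally_bounded:
  assumes traj: "trajectory M k R W \<Phi>" and t: "0 \<le> t"
  shows "\<exists>d>0. \<exists>B\<ge>0. \<forall>s\<ge>0. \<bar>s - t\<bar> < d \<longrightarrow> (AE w in M \<Otimes>\<^sub>M M. \<bar>\<Phi> s w\<bar> \<le> B)"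
proof -
  let ?V = "velocity M k R (\<Phi> t)"
  obtain \<eta> where \<eta>: "\<eta> > 0" "\<And>r. r \<ge> 0 \<Longrightarrow> \<bar>r - t\<bar> < \<eta> \<Longrightarrow>
      (AE w in M \<Otimes>\<^sub>M M. \<bar>\<Phi> r w - \<Phi> t w - (r - t) * ?V w\<bar> \<le> \<bar>r - t\<bar> * 1)"
    using trajectory_step[OF traj t, of 1] by auto
  have bound: "\<exists>C\<ge>0. \<forall>w\<in>space (M \<Otimes>\<^sub>M M). \<bar>\<Phi> s w\<bar> \<le> C" if "s \<ge> 0" for s
  proof -
    have "kernel M (\<Phi> s)" using traj that by (simp add: trajectory_def)
    then obtain C where "\<forall>x\<in>space M. \<forall>y\<in>space M. \<bar>\<Phi> s (x, y)\<bar> \<le> C"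
      by (auto simp: kernel_def)
    then have "\<forall>w\<in>space (M \<Otimes>\<^sub>M M). \<bar>\<Phi> s w\<bar> \<le> max C 0"
      by (auto simp: space_pair_measure le_max_iff_disj)
    then show ?thesis by (intro exI[of _ "max C 0"]) auto
  qed
  define h where "h = \<eta> / 2"
  have h: "h > 0" "h < \<eta>" using \<eta> by (auto simp: h_def)
  obtain C where C: "C \<ge> 0" "\<And>w. w \<in> space (M \<Otimes>\<^sub>M M) \<Longrightarrow> \<bar>\<Phi> t w\<bar> \<le> C" using bound[OF t] by auto
  obtain C' where C': "\<And>w. w \<in> space (M \<Otimes>\<^sub>M M) \<Longrightarrow> \<bar>\<Phi> (t + h) w\<bar> \<le> C'" using bound[of "t + h"] t h by auto
  \<comment> \<open>The velocity at \<open>t\<close> is bounded by means of a single increment of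
    length \<open>h\<close>: \<open>h\<close> times it differs by at most \<open>h\<close> from a
    difference of two bounded kernels.\<close>
  define K where "K = (C + C' + h) / h"
  have step_h: "AE w in M \<Otimes>\<^sub>M M. \<bar>\<Phi> (t + h) w - \<Phi> t w - h * ?V w\<bar> \<le> h"
    using \<eta>(2)[of "t + h"] t h by simp
  have V: "AE w in M \<Otimes>\<^sub>M M. \<bar>?V w\<bar> \<le> K"
    using step_h AE_space
  proof eventually_elim
    case (elim w)
    then have "\<bar>h * ?V w\<bar> \<le> C + C' + h" using C(2)[of w] C'[of w] h by (auto simp: abs_le_iff)
    then show ?case using h by (simp add: K_def abs_mult field_simps)
  qed
  have "AE w in M \<Otimes>\<^sub>M M. \<bar>\<Phi> s w\<bar> \<le> C + \<eta> * (\<bar>K\<bar> + 1)" if s: "s \<ge> 0" "\<bar>s - t\<bar> < \<eta>" for s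
    using \<eta>(2)[OF s] V AE_space
  proof eventually_elim
    case (elim w)
    have "\<bar>(s - t) * ?V w\<bar> \<le> \<eta> * \<bar>K\<bar>"
      unfolding abs_mult using s elim by (intro mult_mono) auto
    moreover have "\<bar>\<Phi> s w\<bar> \<le> \<bar>\<Phi> t w\<bar> + \<bar>(s - t) * ?V w\<bar> + \<bar>\<Phi> s w - \<Phi> t w - (s - t) * ?V w\<bar>"
      by linarith
    moreover have "\<bar>\<Phi> s w - \<Phi> t w - (s - t) * ?V w\<bar> \<le> \<eta>" using elim(1) s by simp
    ultimately show ?case using C(2)[OF elim(3)] by (simp add: distrib_left)
  qed
  then show ?thesis
    using \<eta>(1) C(1) by (intro exI[of _ \<eta>] conjI exI[of _ "C + \<eta> * (\<bar>K\<bar> + 1)"]) auto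
qed

section \<open>The distance from \<open>1\<close> on the rows over \<open>A\<close>\<close>

text \<open>The quantity for the growth argument. Testing only the first coordinate lets the row
  averages in the velocity bound integrate to the defect again.\<close>

definition defect :: "'a measure \<Rightarrow> 'a set \<Rightarrow> ('a \<times> 'a \<Rightarrow> real) \<Rightarrow> real" where
  "defect M A U = (\<integral>w. indicator A (fst w) * \<bar>1 - U w\<bar> \<partial>(M \<Otimes>\<^sub>M M))"

lemma defect_nonneg: "0 \<le> defect M A U"
  by (simp add: defect_def)

lemma integrable_defect:
  assumes "prob_space M" "kernel M U" "A \<in> sets M"
  shows "integrable (M \<Otimes>\<^sub>M M) (\<lambda>w. indicator A (fst w) * \<bar>1 - U w\<bar>)"
proof -
  interpret prob_space M by fact
  interpret pair_prob_space M M ..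
  have [measurable]: "A \<in> sets M" by fact
  have int: "integrable (M \<Otimes>\<^sub>M M) (\<lambda>w. \<bar>1 - U w\<bar>)"
    using integrable_kernel[OF assms(1,2)] by auto
  then have [measurable]: "(\<lambda>w. \<bar>1 - U w\<bar>) \<in> borel_measurable (M \<Otimes>\<^sub>M M)" by auto
  show ?thesis
    by (rule Bochner_Integration.integrable_bound[OF int]) (auto simp: indicator_def)
qed

text \<open>The row average is constant in the second coordinate and \<open>M\<close> has total mass
  \<open>1\<close>, so Fubini gives back the defect. Thus the growth estimate closes on a single
  quantity.\<close>

lemma integral_row_defect:
  assumes "prob_space M" "kernel M U" "A \<in> sets M"
  shows "integrable (M \<Otimes>\<^sub>M M) (\<lambda>w. indicator A (fst w) * (\<integral>z. \<bar>1 - U (fst w, z)\<bar> \<partial>M))"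
    and "(\<integral>w. indicator A (fst w) * (\<integral>z. \<bar>1 - U (fst w, z)\<bar> \<partial>M) \<partial>(M \<Otimes>\<^sub>M M)) = defect M A U"
proof -
  interpret prob_space M by fact
  interpret pair_prob_space M M ..
  define g where "g x = indicator A x * (\<integral>z. \<bar>1 - U (x, z)\<bar> \<partial>M)" for x
  have int: "integrable M g"
    using integrable_fst'[OF integrable_defect[OF assms]] by (simp add: g_def[abs_def])
  have [measurable]: "g \<in> borel_measurable M" using int by auto
  show *: "integrable (M \<Otimes>\<^sub>M M) (\<lambda>w. indicator A (fst w) * (\<integral>z. \<bar>1 - U (fst w, z)\<bar> \<partial>M))"
    unfolding g_def[symmetric]
  proof (rule Fubini_integrable)
    show "integrable M (\<lambda>x. \<integral>y. norm (g (fst (x, y))) \<partial>M)" using int by (simp add: prob_space)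
  qed auto
  show "(\<integral>w. indicator A (fst w) * (\<integral>z. \<bar>1 - U (fst w, z)\<bar> \<partial>M) \<partial>(M \<Otimes>\<^sub>M M)) = defect M A U"
    using integral_fst'[OF *] integral_fst'[OF integrable_defect[OF assms]]
    by (simp add: prob_space.prob_space[OF assms(1)] defect_def)
qed

text \<open>The reverse triangle inequality reduces the claim to the increment of the kernel. The
  factor \<open>2\<close> arises because the pointwise term and the row term each integrate to the
  defect.\<close>

lemma defect_diff_bound:
  assumes M: "prob_space M" and U: "kernel M U" and U': "kernel M U'" and A: "A \<in> sets M"
    and h: "0 \<le> h" and e: "0 \<le> e" and C: "0 \<le> C"
    and le: "AE w in M \<Otimes>\<^sub>M M. \<bar>U' w - U w\<bar> \<le> h * (C * (\<bar>1 - U w\<bar> + (\<integral>z. \<bar>1 - U (fst w, z)\<bar> \<partial>M)) + e)"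
  shows "\<bar>defect M A U' - defect M A U\<bar> \<le> h * (2 * C * defect M A U + e)"
proof -
  interpret prob_space M by fact
  interpret pair_prob_space M M ..
  let ?i = "\<lambda>w. indicator A (fst w) :: real"
  let ?row = "\<lambda>w. (\<integral>z. \<bar>1 - U (fst w, z)\<bar> \<partial>M)"
  let ?f = "\<lambda>w. h * C * (?i w * \<bar>1 - U w\<bar>) + h * C * (?i w * ?row w) + h * e"
  note int = integrable_defect[OF M U A] integrable_defect[OF M U' A] integral_row_defect[OF M U A]
  have "\<bar>defect M A U' - defect M A U\<bar> = \<bar>\<integral>w. ?i w * \<bar>1 - U' w\<bar> - ?i w * \<bar>1 - U w\<bar> \<partial>(M \<Otimes>\<^sub>M M)\<bar>"
    unfolding defect_def using int by simp
  also have "\<dots> \<le> (\<integral>w. \<bar>?i w * \<bar>1 - U' w\<bar> - ?i w * \<bar>1 - U w\<bar>\<bar> \<partial>(M \<Otimes>\<^sub>M M))"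
    by (rule integral_abs_bound)
  also have "\<dots> \<le> (\<integral>w. ?f w \<partial>(M \<Otimes>\<^sub>M M))"
  proof (rule integral_mono_AE')
    show "integrable (M \<Otimes>\<^sub>M M) ?f" using int by auto
    show "AE w in M \<Otimes>\<^sub>M M. 0 \<le> ?f w" using h e C by auto
    show "AE w in M \<Otimes>\<^sub>M M. \<bar>?i w * \<bar>1 - U' w\<bar> - ?i w * \<bar>1 - U w\<bar>\<bar> \<le> ?f w"
      using le
    proof eventually_elim
      case (elim w)
      then show ?case
        using h e by (cases "fst w \<in> A") (auto simp: distrib_left mult.assoc)
    qed
  qed
  also have "\<dots> = h * C * defect M A U + h * C * defect M A U + h * e"
    using int by (simp add: defect_def P.prob_space)
  finally show ?thesis by (simp add: algebra_simps)
qed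

lemma defect_le:
  assumes M: "prob_space M" and "AE w in M \<Otimes>\<^sub>M M. \<bar>U w\<bar> \<le> B" "0 \<le> B"
  shows "defect M A U \<le> 1 + B"
proof -
  interpret prob_space M by fact
  interpret pair_prob_space M M ..
  have "defect M A U \<le> (\<integral>w. 1 + B \<partial>(M \<Otimes>\<^sub>M M))"
    unfolding defect_def
  proof (rule integral_mono_AE')
    show "AE w in M \<Otimes>\<^sub>M M. indicator A (fst w) * \<bar>1 - U w\<bar> \<le> 1 + B"
      using assms(2) by eventually_elim (auto simp: indicator_def assms(3))
  qed (use assms(3) in auto)
  then show ?thesis by (simp add: P.prob_space)
qed

text \<open>Expansion and velocity bound give growth with constant \<open>2 * C\<close>. As
  \<open>C\<close> depends on the essential bound \<open>B\<close>, it is available only near each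
  time, hence the local form of the growth lemma.\<close>

lemma defect_trajectory_zero:
  assumes M: "prob_space M" and A: "A \<in> sets M"
    and k: "1 / 2 * real (k choose 2) \<le> real (k - 1)"
    and traj: "trajectory M k (extremist_rule k) W \<Phi>"
    and W: "\<And>x y. x \<in> A \<Longrightarrow> y \<in> space M \<Longrightarrow> W (x, y) = 1" and t: "0 \<le> t"
  shows "defect M A (\<Phi> t) = 0"
proof (rule zero_of_local_linear_growth[where m = "\<lambda>t. defect M A (\<Phi> t)", OF defect_nonneg _ t])
  have "AE w in M \<Otimes>\<^sub>M M. \<Phi> 0 w = W w" using traj by (simp add: trajectory_def)
  then have "AE w in M \<Otimes>\<^sub>M M. indicator A (fst w) * \<bar>1 - \<Phi> 0 w\<bar> = 0"
    using AE_space
    by eventually_elim (auto simp: space_pair_measure indicator_def W)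
  then show "defect M A (\<Phi> 0) = 0"
    unfolding defect_def by (rule integral_eq_zero_AE)
next
  have ker: "kernel M (\<Phi> s)" if "0 \<le> s" for s using traj that by (simp add: trajectory_def)
  fix x :: real assume "0 \<le> x"
  from trajectory_locally_bounded[OF traj this] obtain d B where d: "d > 0" and B: "0 \<le> B"
    and dB: "\<And>s. s \<ge> 0 \<Longrightarrow> \<bar>s - x\<bar> < d \<Longrightarrow> AE w in M \<Otimes>\<^sub>M M. \<bar>\<Phi> s w\<bar> \<le> B" by auto
  define C where "C = (real (card (graphs_on k)))\<^sup>2 *
    real (card {(a, b). a \<in> {1..k} \<and> b \<in> {1..k} \<and> a \<noteq> b}) * (1 + B) ^ (2 * k\<^sup>2)"
  have C: "0 \<le> C" using B by (simp add: C_def)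
  have "\<exists>\<eta>>0. \<forall>r\<ge>0. \<bar>r - s\<bar> < \<eta> \<longrightarrow> \<bar>defect M A (\<Phi> r) - defect M A (\<Phi> s)\<bar>
      \<le> \<bar>r - s\<bar> * (2 * C * defect M A (\<Phi> s) + e)"
    if s: "0 \<le> s" "\<bar>s - x\<bar> < d" and e: "e > 0" for s e
  proof -
    let ?V = "velocity M k (extremist_rule k) (\<Phi> s)"
    obtain \<eta> where \<eta>: "\<eta> > 0" "\<And>r. r \<ge> 0 \<Longrightarrow> \<bar>r - s\<bar> < \<eta> \<Longrightarrow>
        AE w in M \<Otimes>\<^sub>M M. \<bar>\<Phi> r w - \<Phi> s w - (r - s) * ?V w\<bar> \<le> \<bar>r - s\<bar> * e"
      using trajectory_step[OF traj s(1) e] by auto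
    have "\<bar>defect M A (\<Phi> r) - defect M A (\<Phi> s)\<bar> \<le> \<bar>r - s\<bar> * (2 * C * defect M A (\<Phi> s) + e)"
      if r: "r \<ge> 0" "\<bar>r - s\<bar> < \<eta>" for r
    proof (rule defect_diff_bound[OF M ker[OF s(1)] ker[OF r(1)] A])
      show "AE w in M \<Otimes>\<^sub>M M. \<bar>\<Phi> r w - \<Phi> s w\<bar>
          \<le> \<bar>r - s\<bar> * (C * (\<bar>1 - \<Phi> s w\<bar> + (\<integral>z. \<bar>1 - \<Phi> s (fst w, z)\<bar> \<partial>M)) + e)"
        using \<eta>(2)[OF r] velocity_bound[OF M ker[OF s(1)] dB[OF s] B k]
      proof eventually_elim
        case (elim w)
        have "\<bar>\<Phi> r w - \<Phi> s w\<bar> \<le> \<bar>(r - s) * ?V w\<bar> + \<bar>r - s\<bar> * e" using elim(1) by linarith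
        also have "\<dots> = \<bar>r - s\<bar> * (\<bar>?V w\<bar> + e)" by (simp add: abs_mult distrib_left)
        also have "\<dots> \<le> \<bar>r - s\<bar> * (C * (\<bar>1 - \<Phi> s w\<bar> + (\<integral>z. \<bar>1 - \<Phi> s (fst w, z)\<bar> \<partial>M)) + e)"
          using elim(2) by (intro mult_left_mono) (auto simp: C_def)
        finally show ?case .
      qed
    qed (use e C in auto)
    with \<eta>(1) show ?thesis by blast
  qed
  moreover have "defect M A (\<Phi> s) \<le> 1 + B" if "0 \<le> s" "\<bar>s - x\<bar> < d" for s
    using defect_le[OF M dB[OF that] B] .
  ultimately show "\<exists>d>0. \<exists>B C. \<forall>s\<ge>0. \<bar>s - x\<bar> < d \<longrightarrow> defect M A (\<Phi> s) \<le> B \<and>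
      (\<forall>e>0. \<exists>\<eta>>0. \<forall>r\<ge>0. \<bar>r - s\<bar> < \<eta> \<longrightarrow>
        \<bar>defect M A (\<Phi> r) - defect M A (\<Phi> s)\<bar> \<le> \<bar>r - s\<bar> * (C * defect M A (\<Phi> s) + e))"
    using d by blast
qed

section \<open>Cut distance and the star graphon\<close>

text \<open>A real \<open>SUP\<close> dominates its members only for a family bounded above; the L1
  distance of the two kernels is such a bound.\<close>

lemma set_integral_le_cut_dist:
  assumes M: "prob_space M" and U: "kernel M U" and W: "kernel M W" and S: "S \<in> sets M" "T \<in> sets M"
  shows "\<bar>set_lebesgue_integral (M \<Otimes>\<^sub>M M) (S \<times> T) (\<lambda>z. U z - W z)\<bar> \<le> cut_dist M U W"
proof -
  have int: "integrable (M \<Otimes>\<^sub>M M) (\<lambda>z. U z - W z)"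
    using integrable_kernel[OF M U] integrable_kernel[OF M W] by auto
  have "\<bar>set_lebesgue_integral (M \<Otimes>\<^sub>M M) X (\<lambda>z. U z - W z)\<bar> \<le> (\<integral>z. \<bar>U z - W z\<bar> \<partial>(M \<Otimes>\<^sub>M M))" for X
  proof -
    have "\<bar>set_lebesgue_integral (M \<Otimes>\<^sub>M M) X (\<lambda>z. U z - W z)\<bar>
        \<le> (\<integral>z. \<bar>indicator X z *\<^sub>R (U z - W z)\<bar> \<partial>(M \<Otimes>\<^sub>M M))"
      unfolding set_lebesgue_integral_def by (rule integral_abs_bound)
    also have "\<dots> \<le> (\<integral>z. \<bar>U z - W z\<bar> \<partial>(M \<Otimes>\<^sub>M M))"
      using int by (intro integral_mono_AE') (auto simp: indicator_def)
    finally show ?thesis .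
  qed
  then have "bdd_above ((\<lambda>(S, T). \<bar>set_lebesgue_integral (M \<Otimes>\<^sub>M M) (S \<times> T) (\<lambda>z. U z - W z)\<bar>)
      ` (sets M \<times> sets M))"
    by (intro bdd_aboveI[of _ "\<integral>z. \<bar>U z - W z\<bar> \<partial>(M \<Otimes>\<^sub>M M)"]) auto
  from cSUP_upper[OF _ this, of "(S, T)"] show ?thesis
    using S unfolding cut_dist_def by simp
qed

lemma kernel_zero: "kernel M (\<lambda>_. 0)"
  by (auto simp: kernel_def)

definition star_graphon :: "'a set \<Rightarrow> 'a \<times> 'a \<Rightarrow> real" where
  "star_graphon A = (\<lambda>(x, y). of_bool (x \<in> A \<or> y \<in> A))"

lemma graphon_star:
  assumes [measurable]: "A \<in> sets M"
  shows "graphon M (star_graphon A)"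
proof -
  have "star_graphon A \<in> borel_measurable (M \<Otimes>\<^sub>M M)"
    unfolding star_graphon_def case_prod_unfold of_bool_def by measurable
  then show ?thesis
    by (auto simp: graphon_def kernel_def star_graphon_def intro!: exI[of _ 1])
qed

lemma
  assumes "prob_space M" "A \<in> sets M"
  shows emeasure_pair_Times_space: "emeasure (M \<Otimes>\<^sub>M M) (A \<times> space M) = emeasure M A"
    and emeasure_pair_space_Times: "emeasure (M \<Otimes>\<^sub>M M) (space M \<times> A) = emeasure M A"
proof -
  interpret prob_space M by fact
  show "emeasure (M \<Otimes>\<^sub>M M) (A \<times> space M) = emeasure M A"
    "emeasure (M \<Otimes>\<^sub>M M) (space M \<times> A) = emeasure M A"
    using assms(2) by (simp_all add: emeasure_pair_measure_Times emeasure_space_1)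
qed

lemma norm_one_star_le:
  assumes "prob_space M" and A: "A \<in> sets M"
  shows "norm_one M (star_graphon A) \<le> 2 * measure M A"
proof -
  interpret prob_space M by fact
  interpret pair_prob_space M M ..
  have "norm_one M (star_graphon A)
      \<le> (\<integral>w. indicator (A \<times> space M) w + indicator (space M \<times> A) w \<partial>(M \<Otimes>\<^sub>M M))"
    unfolding norm_one_def
  proof (rule integral_mono_AE')
    show "integrable (M \<Otimes>\<^sub>M M) (\<lambda>w. indicator (A \<times> space M) w + indicator (space M \<times> A) w :: real)"
      using A by (intro Bochner_Integration.integrable_add integrable_real_indicator) (auto simp: less_top[symmetric])
    show "AE w in M \<Otimes>\<^sub>M M. \<bar>star_graphon A w\<bar> \<le> indicator (A \<times> space M) w + indicator (space M \<times> A) w"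
      by (rule AE_I2) (auto simp: star_graphon_def space_pair_measure indicator_def)
  qed auto
  also have "\<dots> = measure (M \<Otimes>\<^sub>M M) (A \<times> space M) + measure (M \<Otimes>\<^sub>M M) (space M \<times> A)"
    using A by (simp add: less_top[symmetric])
  also have "\<dots> = 2 * measure M A"
    using emeasure_pair_Times_space[OF assms] emeasure_pair_space_Times[OF assms]
    by (simp add: measure_def)
  finally show ?thesis .
qed

text \<open>\<open>is_dest\<close> asks for some trajectory, so all of them must be excluded. The
  defect vanishes along each, and the test rectangle \<open>A \<times> space M\<close> then keeps
  the cut distance at least \<open>measure M A\<close>.\<close>

lemma star_not_dest_zero:
  assumes M: "prob_space M" and A: "A \<in> sets M" "0 < measure M A"
    and k: "1 / 2 * real (k choose 2) \<le> real (k - 1)"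
  shows "\<not> is_dest M k (extremist_rule k) (star_graphon A) (\<lambda>_. 0)"
proof
  interpret prob_space M by fact
  interpret pair_prob_space M M ..
  assume "is_dest M k (extremist_rule k) (star_graphon A) (\<lambda>_. 0)"
  then obtain \<Phi> where traj: "trajectory M k (extremist_rule k) (star_graphon A) \<Phi>"
    and lim: "((\<lambda>t. cut_dist M (\<Phi> t) (\<lambda>_. 0)) \<longlongrightarrow> 0) at_top"
    by (auto simp: is_dest_def)
  have "measure M A \<le> cut_dist M (\<Phi> t) (\<lambda>_. 0)" if "0 \<le> t" for t
  proof -
    have ker: "kernel M (\<Phi> t)" using traj that by (simp add: trajectory_def)
    have "defect M A (\<Phi> t) = 0"
      by (rule defect_trajectory_zero[OF M A(1) k traj _ that]) (simp add: star_graphon_def)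
    then have "AE w in M \<Otimes>\<^sub>M M. indicator A (fst w) * \<bar>1 - \<Phi> t w\<bar> = 0"
      using integral_nonneg_eq_0_iff_AE[OF integrable_defect[OF M ker A(1)]] by (simp add: defect_def)
    then have "AE w in M \<Otimes>\<^sub>M M. indicator (A \<times> space M) w *\<^sub>R (\<Phi> t w - 0) = indicator (A \<times> space M) w"
      by eventually_elim (auto simp: indicator_def split: if_splits)
    then have "set_lebesgue_integral (M \<Otimes>\<^sub>M M) (A \<times> space M) (\<lambda>z. \<Phi> t z - 0)
        = (\<integral>w. indicator (A \<times> space M) w \<partial>(M \<Otimes>\<^sub>M M))"
      unfolding set_lebesgue_integral_def
      using A ker by (intro integral_cong_AE) (auto simp: kernel_def)
    also have "\<dots> = measure (M \<Otimes>\<^sub>M M) (A \<times> space M)"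
      using A by (simp add: less_top[symmetric])
    also have "\<dots> = measure M A"
      using emeasure_pair_Times_space[OF M A(1)] by (simp add: measure_def)
    finally show ?thesis
      using set_integral_le_cut_dist[OF M ker kernel_zero A(1), of "space M"] by simp
  qed
  then have "eventually (\<lambda>t. measure M A \<le> cut_dist M (\<Phi> t) (\<lambda>_. 0)) at_top"
    using eventually_ge_at_top[of 0] by (rule eventually_mono[rotated]) auto
  with lim have "measure M A \<le> 0" by (rule tendsto_lowerbound) simp
  with A show False by simp
qed

section \<open>The zero graphon\<close>

text \<open>A nonempty \<open>F\<close> has induced density zero, since one of its edges contributes
  the factor \<open>0\<close>. The empty graph is kept by the rule, also in the tie where there are
  no pairs at all.\<close>

lemma velocity_zero: "velocity M k (extremist_rule k) (\<lambda>_. 0) w = 0"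
proof -
  have t: "t_ind M k F a b (\<lambda>_. 0) x y = 0" if F: "F \<in> graphs_on k" "F \<noteq> {}" for F a b x y
  proof -
    obtain e where e: "e \<in> F" "e \<subseteq> {1..k}" "card e = 2"
      using F by (auto simp: graphs_on_def complete_graph_on_def)
    then obtain p q where pq: "e = {p, q}" "p \<noteq> q" by (auto simp: card_2_iff)
    let ?E = "{(i, j). i \<in> {1..k} \<and> j \<in> {1..k} \<and> i < j \<and> {i, j} \<in> F}"
    have "finite ?E" by (rule finite_subset[of _ "{1..k} \<times> {1..k}"]) auto
    moreover have "(min p q, max p q) \<in> ?E"
      using e pq by (auto simp: min_def max_def insert_commute)
    \<comment> \<open>Over an empty or infinite index set the product of zeros would be
      \<open>1\<close>, so the set must be shown finite and nonempty.\<close>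
    ultimately have "card ?E \<noteq> 0" unfolding card_eq_0_iff by blast
    then have "(\<Prod>(i, j)\<in>?E. 0 :: real) = 0" by (simp add: case_prod_unfold)
    then show ?thesis unfolding t_ind_def Let_def by simp
  qed
  have "extremist_rule k F H * t_ind M k F a b (\<lambda>_. 0) x y *
         (of_bool ({a, b} \<in> H - F) - of_bool ({a, b} \<in> F - H)) = 0"
    if "F \<in> graphs_on k" for F H a b x y
  proof (cases "F = {}")
    case True
    then show ?thesis by (auto simp: extremist_rule_def)
  qed (use t[OF that] in simp)
  then show ?thesis by (auto simp: velocity_def case_prod_unfold intro!: sum.neutral)
qed

text \<open>The initial condition holds up to null sets, so the constant zero curve is a trajectory
  of \<open>W\<close>. This puts \<open>p = 0\<close> into the set defining the threshold, whose
  \<open>Sup\<close> is then not taken over the empty set.\<close>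

lemma null_graphon_dest_zero:
  assumes M: "prob_space M" and W: "graphon M W" and null: "norm_one M W \<le> 0"
  shows "is_dest M k (extremist_rule k) W (\<lambda>_. 0)"
proof -
  interpret prob_space M by fact
  interpret pair_prob_space M M ..
  have "kernel M W" using W by (simp add: graphon_def)
  then have "integrable (M \<Otimes>\<^sub>M M) (\<lambda>w. \<bar>W w\<bar>)" using integrable_kernel[OF M] by auto
  moreover have "(\<integral>w. \<bar>W w\<bar> \<partial>(M \<Otimes>\<^sub>M M)) = 0"
    using null by (intro antisym) (auto simp: norm_one_def)
  ultimately have W0: "AE w in M \<Otimes>\<^sub>M M. \<bar>W w\<bar> = 0"
    by (subst (asm) integral_nonneg_eq_0_iff_AE) auto
  have "norm_inf M (\<lambda>_. 0) = 0"
    unfolding norm_inf_def by (simp add: esssup_const P.emeasure_space_1 zero_ereal_def[symmetric])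
  then have "trajectory M k (extremist_rule k) W (\<lambda>_ _. 0)"
    using W0 by (auto simp: trajectory_def kernel_zero velocity_zero)
  moreover have "cut_dist M (\<lambda>_. 0) (\<lambda>_. 0) = 0"
  proof -
    have "cut_dist M (\<lambda>_. 0) (\<lambda>_. 0) = (SUP p\<in>sets M \<times> sets M. 0)"
      by (simp add: cut_dist_def case_prod_unfold)
    also have "\<dots> = 0" by (rule cSUP_const) (use sets.top[of M] in blast)
    finally show ?thesis .
  qed
  moreover have "graphon M (\<lambda>_. 0)" by (auto simp: graphon_def kernel_zero)
  ultimately show ?thesis
    unfolding is_dest_def by (intro conjI exI[of _ "\<lambda>_ _. 0"]) auto
qed

section \<open>The density threshold\<close>

text \<open>The condition on \<open>k\<close> compares half of all pairs with the number of edges at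
  a full vertex: \<open>3 / 2 \<le> 2\<close> for \<open>k = 3\<close>, and \<open>3 \<le> 3\<close>
  for \<open>k = 4\<close>, where the tie rule matters. A star over a set of measure below
  \<open>p / 2\<close> has norm at most \<open>p\<close> and refutes every positive
  \<open>p\<close>.\<close>

lemma density_threshold_eq_0:
  assumes M: "prob_space M" and "atomless M" and k: "1 / 2 * real (k choose 2) \<le> real (k - 1)"
  shows "density_threshold M k = 0"
proof -
  have "p = 0" if p: "p \<in> {0..1}"
    "\<forall>W. graphon M W \<longrightarrow> norm_one M W \<le> p \<longrightarrow> is_dest M k (extremist_rule k) W (\<lambda>_. 0)" for p :: real
  proof (rule ccontr)
    assume "p \<noteq> 0"
    then have "p / 2 > 0" using p by auto
    then obtain A where A: "A \<in> sets M" "0 < measure M A" "measure M A < p / 2"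
      using exists_small_positive_set[OF assms(1,2)] by blast
    then have "norm_one M (star_graphon A) \<le> p" using norm_one_star_le[OF M A(1)] by linarith
    then show False
      using p(2) graphon_star[OF A(1)] star_not_dest_zero[OF M A(1,2) k] by blast
  qed
  then have "{p \<in> {0..1}. \<forall>W. graphon M W \<longrightarrow> norm_one M W \<le> p \<longrightarrow>
            is_dest M k (extremist_rule k) W (\<lambda>_. 0)} = {0}"
    using null_graphon_dest_zero[OF M] by fastforce
  then show ?thesis by (simp add: density_threshold_def)
qed

theorem theorem7p5:
  fixes M :: "'a measure"
  assumes "prob_space M"
    and "atomless M"
    and "separable_sigma_algebra M"
  shows "density_threshold M 3 = 0 \<and> density_threshold M 4 = 0"
  using assms by (simp add: density_threshold_eq_0 choose_two)

end
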